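(* Let $\nabla$ be the Levi-Civita connection of $(SPD(n),g_W)$. For all smooth vector fields $X,Y$ on $SPD(n)$, at every point $A\in SPD(n)$, $$\nabla_XY=\mathrm dY(X)-\Gamma_A[X]\,A\,\Gamma_A[Y]-\Gamma_A[Y]\,A\,\Gamma_A[X].$$
   Context: $SPD(n)$ is the set of real symmetric positive-definite $n\times n$ matrices, an open subset of the space $Sym(n)$ of real symmetric matrices, so $T_ASPD(n)\cong Sym(n)$. For $A\in SPD(n)$ and a real $n\times n$ matrix $X$, $\Gamma_A[X]$ denotes the unique real matrix satisfying $A\,\Gamma_A[X]+\Gamma_A[X]\,A=X$. The Wasserstein metric is the Riemannian metric $g_W|_A(X,Y)=\mathrm{tr}(\Gamma_A[Y]\,A\,\Gamma_A[X])=\frac12\mathrm{tr}(\Gamma_A[Y]X)$ for $X,Y\in T_ASPD(n)$. Vector fields on $SPD(n)$ are regarded as smooth maps $SPD(n)\to Sym(n)$, and $\mathrm dY(X)$ is the ordinary directional derivative of the map $Y$ in the direction $X$. *)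

theory Defs
  imports "HOL-Analysis.Analysis"
begin

text \<open>
  Calculus on a set \<open>U\<close> that is relatively open in a linear subspace \<open>V\<close> of the ambient
  space, all tangent spaces of \<open>U\<close> being identified with \<open>V\<close>.  Maps on \<open>U\<close> are represented
  by functions on the whole ambient type whose values outside \<open>U\<close> are irrelevant.
\<close>

text \<open>
  For \<open>p \<in> U\<close> and \<open>v \<in> V\<close> the point \<open>p + t *\<^sub>R v\<close> stays in \<open>U\<close> for small \<open>t\<close>, so
  this depends only on the values of \<open>f\<close> on \<open>U\<close>.
\<close>

definition dirderiv ::
    "('a::real_normed_vector \<Rightarrow> 'b::real_normed_vector) \<Rightarrow> 'a \<Rightarrow> 'a \<Rightarrow> 'b" where
  "dirderiv f p v = vector_derivative (\<lambda>t::real. f (p + t *\<^sub>R v)) (at 0)"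

text \<open>
  Since \<open>U\<close> is relatively open in \<open>V\<close>, differentiability at \<open>p\<close> within \<open>U\<close> is
  Frechet differentiability of \<open>f\<close> as a map on an open subset of \<open>V\<close>.
\<close>

primrec Ck_on ::
    "'a::euclidean_space set \<Rightarrow> 'a set \<Rightarrow> nat \<Rightarrow> ('a \<Rightarrow> 'b::real_normed_vector) \<Rightarrow> bool" where
  "Ck_on V U 0 f \<longleftrightarrow> continuous_on U f"
| "Ck_on V U (Suc k) f \<longleftrightarrow>
     (\<forall>p\<in>U. f differentiable (at p within U)) \<and>
     (\<forall>v\<in>V. Ck_on V U k (\<lambda>p. dirderiv f p v))"

definition smooth_map ::
    "'a::euclidean_space set \<Rightarrow> 'a set \<Rightarrow> ('a \<Rightarrow> 'b::real_normed_vector) \<Rightarrow> bool" where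
  "smooth_map V U f \<longleftrightarrow> (\<forall>k. Ck_on V U k f)"

definition vector_field ::
    "'a::euclidean_space set \<Rightarrow> 'a set \<Rightarrow> ('a \<Rightarrow> 'a) \<Rightarrow> bool" where
  "vector_field V U X \<longleftrightarrow> smooth_map V U X \<and> (\<forall>p\<in>U. X p \<in> V)"

definition lie_bracket ::
    "('a::real_normed_vector \<Rightarrow> 'a) \<Rightarrow> ('a \<Rightarrow> 'a) \<Rightarrow> 'a \<Rightarrow> 'a" where
  "lie_bracket X Y p = dirderiv Y p (X p) - dirderiv X p (Y p)"

text \<open>
  The second clause says that \<open>nabla\<close> is well defined on vector fields on \<open>U\<close>, which
  are functions on the ambient type up to agreement on \<open>U\<close>.
\<close>

definition affine_connection ::
    "'a::euclidean_space set \<Rightarrow> 'a set \<Rightarrow> (('a \<Rightarrow> 'a) \<Rightarrow> ('a \<Rightarrow> 'a) \<Rightarrow> ('a \<Rightarrow> 'a)) \<Rightarrow> bool" where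
  "affine_connection V U nabla \<longleftrightarrow>
     (\<forall>X Y. vector_field V U X \<longrightarrow> vector_field V U Y \<longrightarrow> vector_field V U (nabla X Y)) \<and>
     (\<forall>X X' Y Y'. vector_field V U X \<longrightarrow> vector_field V U X' \<longrightarrow>
        vector_field V U Y \<longrightarrow> vector_field V U Y' \<longrightarrow>
        (\<forall>p\<in>U. X p = X' p) \<longrightarrow> (\<forall>p\<in>U. Y p = Y' p) \<longrightarrow>
        (\<forall>p\<in>U. nabla X Y p = nabla X' Y' p)) \<and>
     (\<forall>X X' Y. vector_field V U X \<longrightarrow> vector_field V U X' \<longrightarrow> vector_field V U Y \<longrightarrow>
        (\<forall>p\<in>U. nabla (\<lambda>q. X q + X' q) Y p = nabla X Y p + nabla X' Y p)) \<and>
     (\<forall>(f::'a \<Rightarrow> real) X Y. smooth_map V U f \<longrightarrow> vector_field V U X \<longrightarrow> vector_field V U Y \<longrightarrow>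
        (\<forall>p\<in>U. nabla (\<lambda>q. f q *\<^sub>R X q) Y p = f p *\<^sub>R nabla X Y p)) \<and>
     (\<forall>X Y Y'. vector_field V U X \<longrightarrow> vector_field V U Y \<longrightarrow> vector_field V U Y' \<longrightarrow>
        (\<forall>p\<in>U. nabla X (\<lambda>q. Y q + Y' q) p = nabla X Y p + nabla X Y' p)) \<and>
     (\<forall>(f::'a \<Rightarrow> real) X Y. smooth_map V U f \<longrightarrow> vector_field V U X \<longrightarrow> vector_field V U Y \<longrightarrow>
        (\<forall>p\<in>U. nabla X (\<lambda>q. f q *\<^sub>R Y q) p = dirderiv f p (X p) *\<^sub>R Y p + f p *\<^sub>R nabla X Y p))"

definition torsion_free ::
    "'a::euclidean_space set \<Rightarrow> 'a set \<Rightarrow> (('a \<Rightarrow> 'a) \<Rightarrow> ('a \<Rightarrow> 'a) \<Rightarrow> ('a \<Rightarrow> 'a)) \<Rightarrow> bool" where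
  "torsion_free V U nabla \<longleftrightarrow>
     (\<forall>X Y. vector_field V U X \<longrightarrow> vector_field V U Y \<longrightarrow>
        (\<forall>p\<in>U. nabla X Y p - nabla Y X p = lie_bracket X Y p))"

definition metric_compatible ::
    "'a::euclidean_space set \<Rightarrow> 'a set \<Rightarrow> ('a \<Rightarrow> 'a \<Rightarrow> 'a \<Rightarrow> real) \<Rightarrow>
     (('a \<Rightarrow> 'a) \<Rightarrow> ('a \<Rightarrow> 'a) \<Rightarrow> ('a \<Rightarrow> 'a)) \<Rightarrow> bool" where
  "metric_compatible V U g nabla \<longleftrightarrow>
     (\<forall>X Y Z. vector_field V U X \<longrightarrow> vector_field V U Y \<longrightarrow> vector_field V U Z \<longrightarrow>
        (\<forall>p\<in>U. dirderiv (\<lambda>q. g q (Y q) (Z q)) p (X p) =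
               g p (nabla X Y p) (Z p) + g p (Y p) (nabla X Z p)))"

definition levi_civita ::
    "'a::euclidean_space set \<Rightarrow> 'a set \<Rightarrow> ('a \<Rightarrow> 'a \<Rightarrow> 'a \<Rightarrow> real) \<Rightarrow>
     (('a \<Rightarrow> 'a) \<Rightarrow> ('a \<Rightarrow> 'a) \<Rightarrow> ('a \<Rightarrow> 'a)) \<Rightarrow> bool" where
  "levi_civita V U g nabla \<longleftrightarrow>
     affine_connection V U nabla \<and> torsion_free V U nabla \<and> metric_compatible V U g nabla"

definition Sym :: "(real^'n^'n) set" where
  "Sym = {A. transpose A = A}"

definition SPD :: "(real^'n^'n) set" where
  "SPD = {A \<in> Sym. \<forall>x. x \<noteq> 0 \<longrightarrow> x \<bullet> (A *v x) > 0}"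

definition Gam :: "real^'n^'n \<Rightarrow> real^'n^'n \<Rightarrow> real^'n^'n" where
  "Gam A X = (THE G. A ** G + G ** A = X)"

definition gW :: "real^'n^'n \<Rightarrow> real^'n^'n \<Rightarrow> real^'n^'n \<Rightarrow> real" where
  "gW A X Y = trace (Gam A Y ** A ** Gam A X)"

end

theory Submission
  imports Defs
begin

text \<open>
  The right-hand side is itself torsion free, and it is metric compatible: along \<open>A + t V\<close> the
  solution \<open>G\<close> of \<open>A G + G A = Y\<close> satisfies \<open>G' = Gam A (Y' - V G - G V)\<close>, and the claim follows from
  \<open>2 g(X, Y) = tr (Gam A X ** Y)\<close> and the cyclicity of the trace.  The difference of two such
  operators is a trilinear form symmetric in the first two and antisymmetric in the last two
  arguments, so it vanishes.
\<close>

subsection \<open>Uniqueness of the Levi-Civita connection\<close>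

lemma Ck_on_const: "Ck_on V U k (\<lambda>_. c)"
proof (induction k arbitrary: c)
  case (Suc k)
  have "dirderiv (\<lambda>_. c) p v = 0" for p v :: 'a
    unfolding dirderiv_def by (rule vector_derivative_at) (auto intro: derivative_eq_intros)
  then show ?case using Suc by simp
qed simp

text \<open>Extends a tangent vector at one point to a global field, as the uniqueness argument
  needs for its test field.\<close>

lemma vector_field_const: "c \<in> V \<Longrightarrow> vector_field V U (\<lambda>_. c)"
  by (simp add: vector_field_def smooth_map_def Ck_on_const)

text \<open>The Lie bracket and the derivative of the metric are common to both operators, so they
  drop out of the difference \<open>S\<close>. The linear-algebra hypotheses on \<open>g\<close>
  concern the single point \<open>p\<close>.\<close>

lemma torsion_free_metric_compatible_unique:
  assumes torsion: "torsion_free V U D" "torsion_free V U D'"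
    and compat: "metric_compatible V U g D" "metric_compatible V U g D'"
    and X: "vector_field V U X" and Y: "vector_field V U Y" and p: "p \<in> U"
    and V: "subspace V"
    and D_in: "\<And>X Y. vector_field V U X \<Longrightarrow> vector_field V U Y \<Longrightarrow> D X Y p \<in> V"
    and D'_in: "\<And>X Y. vector_field V U X \<Longrightarrow> vector_field V U Y \<Longrightarrow> D' X Y p \<in> V"
    and diff: "\<And>u v w. u \<in> V \<Longrightarrow> v \<in> V \<Longrightarrow> w \<in> V \<Longrightarrow> g p (u - v) w = g p u w - g p v w"
    and sym: "\<And>u v. u \<in> V \<Longrightarrow> v \<in> V \<Longrightarrow> g p u v = g p v u"
    and definite: "\<And>v. v \<in> V \<Longrightarrow> g p v v = 0 \<Longrightarrow> v = 0"
  shows "D X Y p = D' X Y p"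
proof -
  define S where "S X Y = D X Y p - D' X Y p" for X Y
  have S_in: "S X Y \<in> V" if "vector_field V U X" "vector_field V U Y" for X Y
    unfolding S_def by (rule subspace_diff[OF V D_in[OF that] D'_in[OF that]])
  have S_sym: "S X Y = S Y X" if "vector_field V U X" "vector_field V U Y" for X Y
  proof -
    have "D X Y p - D Y X p = D' X Y p - D' Y X p"
      using torsion that p by (simp add: torsion_free_def)
    then show ?thesis unfolding S_def by (simp add: algebra_simps)
  qed
  have S_skew: "g p (S X Y) (Z p) = - g p (S X Z) (Y p)"
    if v: "vector_field V U X" "vector_field V U Y" "vector_field V U Z" for X Y Z
  proof -
    have in_V: "Y p \<in> V" "Z p \<in> V" using v p by (auto simp: vector_field_def)
    have "g p (D X Y p) (Z p) + g p (Y p) (D X Z p) = g p (D' X Y p) (Z p) + g p (Y p) (D' X Z p)"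
      using compat v p by (simp add: metric_compatible_def)
    then show ?thesis
      using in_V v by (simp add: S_def diff sym[of "Y p"] D_in D'_in)
  qed
  \<comment> \<open>The test field extends the value \<open>S X Y\<close> constantly, so the cycle
    below ends in \<open>g p v v = 0\<close> for \<open>v = S X Y\<close>.\<close>
  define Z where "Z = (\<lambda>_::'a. S X Y)"
  have Z: "vector_field V U Z"
    unfolding Z_def by (rule vector_field_const[OF S_in[OF X Y]])
  \<comment> \<open>Each of the three equalities uses skewness once and symmetry once; the arguments
    return to their start after three sign changes.\<close>
  have "g p (S X Y) (Z p) = - g p (S Z X) (Y p)"
    using S_skew[OF X Y Z] S_sym[OF X Z] by simp
  also have "\<dots> = g p (S Y Z) (X p)"
    using S_skew[OF Z X Y] S_sym[OF Z Y] by simp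
  also have "\<dots> = - g p (S X Y) (Z p)"
    using S_skew[OF Y Z X] S_sym[OF X Y] by simp
  finally have "g p (S X Y) (S X Y) = 0" by (simp add: Z_def)
  then show ?thesis using definite S_in[OF X Y] by (fastforce simp: S_def)
qed

subsection \<open>The Lyapunov equation\<close>

lemma bounded_bilinear_matrix_mult:
  "bounded_bilinear ((**) :: real^'m^'n \<Rightarrow> real^'k^'m \<Rightarrow> real^'k^'n)"
  unfolding bilinear_conv_bounded_bilinear[symmetric] bilinear_def
  by (intro conjI allI linearI)
    (simp_all add: vec_eq_iff matrix_matrix_mult_def distrib_left distrib_right sum.distrib
      sum_distrib_left mult_ac)

text \<open>Provides distributivity over sums, differences and scalars, and the product rule for
  derivatives.\<close>

interpretation matrix_mult:
  bounded_bilinear "(**) :: real^'m^'n \<Rightarrow> real^'k^'m \<Rightarrow> real^'k^'n"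
  by (rule bounded_bilinear_matrix_mult)

lemma linear_trace: "linear (trace :: real^'n^'n \<Rightarrow> real)"
  by (rule linearI) (simp_all add: trace_def sum.distrib sum_distrib_left)

lemma linear_transpose: "linear (transpose :: real^'n^'m \<Rightarrow> real^'m^'n)"
  by (rule linearI) (simp_all add: transpose_def vec_eq_iff)

lemma trace_transpose: "trace (transpose A) = trace A"
  by (simp add: trace_def transpose_def)

lemma subspace_Sym: "subspace (Sym :: (real^'n^'n) set)"
  unfolding subspace_def Sym_def
  by (simp add: linear_0[OF linear_transpose] linear_add[OF linear_transpose]
      linear_scale[OF linear_transpose])

text \<open>Splitting into columns carries the positivity of the quadratic form of \<open>A\<close>
  from vectors to matrices.\<close>

lemma trace_congruence:
  "trace (transpose B ** A ** B) = (\<Sum>j\<in>UNIV. column j B \<bullet> (A *v column j B))"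
  for A :: "real^'n^'n" and B :: "real^'m^'n"
  unfolding matrix_mul_assoc[symmetric]
  by (simp add: trace_def matrix_matrix_mult_def transpose_def
      column_def matrix_vector_mult_def inner_vec_def)

lemma trace_congruence_nonneg:
  assumes "A \<in> SPD" shows "0 \<le> trace (transpose B ** A ** B)"
  unfolding trace_congruence
proof (rule sum_nonneg)
  fix j
  show "0 \<le> column j B \<bullet> (A *v column j B)"
    using assms by (cases "column j B = 0") (auto simp: SPD_def intro: less_imp_le)
qed

lemma trace_congruence_eq_0:
  assumes A: "A \<in> SPD" and 0: "trace (transpose B ** A ** B) = 0"
  shows "B = 0"
proof -
  have nonneg: "0 \<le> x \<bullet> (A *v x)" for x
    using A by (cases "x = 0") (auto simp: SPD_def intro: less_imp_le)
  have "column j B \<bullet> (A *v column j B) = 0" for j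
    using 0 nonneg unfolding trace_congruence by (simp add: sum_nonneg_eq_0_iff)
  then have "column j B = 0" for j
    using A unfolding SPD_def by force
  then show ?thesis by (simp add: column_def vec_eq_iff)
qed

section \<open>Solvability of the Lyapunov equation and symmetries of its solution\<close>

text \<open>Multiplying by \<open>transpose G\<close> and taking traces leaves two nonnegative
  congruence traces with sum 0. \<open>G\<close> is an arbitrary matrix because the description in
  \<open>Gam\<close> ranges over all matrices.\<close>

lemma lyapunov_injective:
  assumes A: "A \<in> SPD" and 0: "A ** G + G ** A = 0"
  shows "G = 0"
proof -
  \<comment> \<open>Cyclicity turns the trace of \<open>transpose G ** G ** A\<close> into the
    congruence trace of \<open>transpose G\<close>.\<close>
  have "trace (transpose G ** (A ** G + G ** A))
      = trace (transpose G ** A ** G) + trace (G ** A ** transpose G)"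
    using trace_mul_sym[of "transpose G" "G ** A"]
    by (simp add: matrix_add_ldistrib trace_add matrix_mul_assoc)
  then have "trace (transpose G ** A ** G) + trace (G ** A ** transpose G) = 0"
    using 0 by (simp add: matrix_mult.zero_right linear_0[OF linear_trace])
  then have "trace (transpose G ** A ** G) = 0"
    using trace_congruence_nonneg[OF A, of G] trace_congruence_nonneg[OF A, of "transpose G"]
    by simp
  then show ?thesis by (rule trace_congruence_eq_0[OF A])
qed

lemma linear_lyapunov: "linear (\<lambda>G. A ** G + G ** A)" for A :: "real^'n^'n"
  by (rule linearI) (simp_all add: matrix_mult.add_left matrix_mult.add_right
      matrix_mult.scaleR_left matrix_mult.scaleR_right algebra_simps)

lemma lyapunov_unique:
  assumes A: "A \<in> SPD" and eq: "A ** G + G ** A = A ** H + H ** A"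
  shows "G = H"
proof -
  have "A ** (G - H) + (G - H) ** A = 0"
    using linear_diff[OF linear_lyapunov, of A G H] eq by simp
  from lyapunov_injective[OF A this] show ?thesis by simp
qed

text \<open>An injective linear endomorphism of a finite-dimensional space is onto, so the definite
  description in \<open>Gam\<close> does denote a solution.\<close>

lemma Gam_solves:
  assumes A: "A \<in> SPD"
  shows "A ** Gam A X + Gam A X ** A = X"
proof -
  have "inj (\<lambda>G. A ** G + G ** A)"
    using lyapunov_unique[OF A] by (auto intro: injI)
  then have "surj (\<lambda>G. A ** G + G ** A)"
    by (rule linear_inj_imp_surj[OF linear_lyapunov])
  then obtain G where G: "X = A ** G + G ** A" by (rule surjE)
  have "\<exists>!G. A ** G + G ** A = X"
  proof (rule ex1I)
    show "A ** G + G ** A = X" by (rule G[symmetric])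
    show "H = G" if "A ** H + H ** A = X" for H
      by (rule lyapunov_unique[OF A]) (simp only: that G[symmetric])
  qed
  then show ?thesis unfolding Gam_def by (rule theI')
qed

lemma Gam_eqI: "A \<in> SPD \<Longrightarrow> A ** G + G ** A = X \<Longrightarrow> Gam A X = G"
  by (metis lyapunov_unique Gam_solves)

lemma linear_Gam:
  assumes A: "A \<in> SPD" shows "linear (Gam A)"
proof (rule linearI)
  show "Gam A (X + Y) = Gam A X + Gam A Y" for X Y
    using linear_add[OF linear_lyapunov, of A "Gam A X" "Gam A Y"]
    by (intro Gam_eqI[OF A]) (simp add: Gam_solves[OF A])
  show "Gam A (c *\<^sub>R X) = c *\<^sub>R Gam A X" for c X
    using linear_scale[OF linear_lyapunov, of A c "Gam A X"]
    by (intro Gam_eqI[OF A]) (simp add: Gam_solves[OF A])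
qed

text \<open>Transposing the equation shows that the transpose of the solution solves it as well;
  uniqueness applies.\<close>

lemma Gam_Sym:
  assumes A: "A \<in> SPD" and X: "X \<in> Sym"
  shows "Gam A X \<in> Sym"
proof -
  let ?G = "Gam A X"
  have "transpose (A ** ?G + ?G ** A) = A ** transpose ?G + transpose ?G ** A"
    using A by (simp add: linear_add[OF linear_transpose] matrix_transpose_mul SPD_def Sym_def)
  then have "Gam A X = transpose ?G"
    using X by (intro Gam_eqI[OF A]) (simp add: Gam_solves[OF A] Sym_def)
  then show ?thesis by (simp add: Sym_def)
qed

text \<open>By cyclicity the Lyapunov operator is self-adjoint for the form
  \<open>trace (G ** H)\<close>, hence so is its inverse \<open>Gam A\<close>.\<close>

lemma trace_Gam_commute:
  assumes A: "A \<in> SPD"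
  shows "trace (Gam A X ** Y) = trace (Gam A Y ** X)"
proof -
  let ?G = "Gam A X" and ?H = "Gam A Y"
  have "trace (?G ** Y) = trace (?G ** (A ** ?H + ?H ** A))"
    by (simp add: Gam_solves[OF A])
  also have "\<dots> = trace (?G ** A ** ?H) + trace (?G ** ?H ** A)"
    by (simp add: matrix_add_ldistrib trace_add matrix_mul_assoc)
  also have "\<dots> = trace (?H ** (A ** ?G + ?G ** A))"
    using trace_mul_sym[of "?G ** A" ?H] trace_mul_sym[of ?G "?H ** A"]
    by (simp add: matrix_add_ldistrib trace_add matrix_mul_assoc)
  finally show ?thesis by (simp add: Gam_solves[OF A])
qed

section \<open>The Wasserstein metric as an inner product on symmetric matrices\<close>

text \<open>Substituting \<open>Y = A ** H + H ** A\<close> splits the trace into two parts that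
  transposition and cyclicity identify. With a single \<open>Gam\<close> left, this form is easier
  to differentiate.\<close>

lemma gW_eq_trace:
  assumes A: "A \<in> SPD" and X: "X \<in> Sym" and Y: "Y \<in> Sym"
  shows "gW A X Y = trace (Gam A X ** Y) / 2"
proof -
  let ?G = "Gam A X" and ?H = "Gam A Y"
  have "transpose ?G = ?G" "transpose ?H = ?H" "transpose A = A"
    using Gam_Sym[OF A X] Gam_Sym[OF A Y] A by (auto simp: Sym_def SPD_def)
  then have "trace (?G ** A ** ?H) = gW A X Y"
    unfolding gW_def
    by (metis matrix_transpose_mul trace_transpose matrix_mul_assoc)
  moreover have "trace (?G ** ?H ** A) = trace (?H ** A ** ?G)"
    using trace_mul_sym[of ?G "?H ** A"] by (simp add: matrix_mul_assoc)
  moreover have "trace (?G ** Y) = trace (?G ** A ** ?H) + trace (?G ** ?H ** A)"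
    using Gam_solves[OF A, of Y] by (metis matrix_add_ldistrib trace_add matrix_mul_assoc)
  ultimately show ?thesis by (simp add: gW_def)
qed

lemma gW_commute: "A \<in> SPD \<Longrightarrow> X \<in> Sym \<Longrightarrow> Y \<in> Sym \<Longrightarrow> gW A X Y = gW A Y X"
  by (simp add: gW_eq_trace trace_Gam_commute)

lemma gW_diff_left:
  assumes "A \<in> SPD" shows "gW A (X - Y) Z = gW A X Z - gW A Y Z"
  by (simp add: gW_def linear_diff[OF linear_Gam[OF assms]] matrix_mult.diff_right trace_sub)

text \<open>As \<open>Gam A X\<close> is symmetric, \<open>gW A X X\<close> is its congruence trace,
  which vanishes only at 0.\<close>

lemma gW_definite:
  assumes A: "A \<in> SPD" and X: "X \<in> Sym" and 0: "gW A X X = 0"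
  shows "X = 0"
proof -
  have "transpose (Gam A X) = Gam A X" using Gam_Sym[OF A X] by (simp add: Sym_def)
  then have "Gam A X = 0"
    using trace_congruence_eq_0[OF A, of "Gam A X"] 0 by (simp add: gW_def)
  then show ?thesis using Gam_solves[OF A, of X] by simp
qed

subsection \<open>Derivatives along lines\<close>

text \<open>On the unit sphere the quadratic form of \<open>A\<close> has a positive minimum
  \<open>m\<close>, and that of \<open>V\<close> is bounded by the operator norm \<open>K\<close>.
  The filter \<open>nhds 0\<close> includes \<open>t = 0\<close>, as the transfer of derivatives
  requires.\<close>

lemma SPD_eventually:
  assumes A: "A \<in> SPD" and V: "V \<in> (Sym :: (real^'n^'n) set)"
  shows "\<forall>\<^sub>F t::real in nhds 0. A + t *\<^sub>R V \<in> SPD"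
proof -
  have "\<exists>x\<in>sphere 0 1. \<forall>y\<in>sphere (0::real^'n) 1. x \<bullet> (A *v x) \<le> y \<bullet> (A *v y)"
    by (rule continuous_attains_inf) (auto intro!: continuous_intros simp: linear_continuous_on)
  then obtain x :: "real^'n" where x: "norm x = 1"
    and min: "\<And>y. norm y = 1 \<Longrightarrow> x \<bullet> (A *v x) \<le> y \<bullet> (A *v y)"
    by auto
  define m where "m = x \<bullet> (A *v x)"
  have m: "0 < m" using x A unfolding m_def SPD_def by (metis (mono_tags, lifting) mem_Collect_eq norm_zero zero_neq_one)
  define K where "K = onorm ((*v) V)"
  have K: "0 \<le> K" unfolding K_def by (simp add: onorm_pos_le)
  have in_SPD: "A + t *\<^sub>R V \<in> SPD" if t: "\<bar>t\<bar> * K < m" for t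
  proof -
    have "0 < y \<bullet> ((A + t *\<^sub>R V) *v y)" if y: "y \<noteq> 0" for y
    proof -
      \<comment> \<open>Homogeneity of degree 2 reduces positivity to unit vectors.\<close>
      define u where "u = y /\<^sub>R norm y"
      have u: "norm u = 1" "y = norm y *\<^sub>R u" using y by (simp_all add: u_def)
      have "\<bar>u \<bullet> (V *v u)\<bar> \<le> norm u * norm (V *v u)" by (rule Cauchy_Schwarz_ineq2)
      also have "\<dots> \<le> K" using onorm[of "(*v) V" u] u by (simp add: K_def)
      finally have "\<bar>t * (u \<bullet> (V *v u))\<bar> \<le> \<bar>t\<bar> * K" by (simp add: abs_mult mult_left_mono)
      then have "0 < u \<bullet> (A *v u) + t * (u \<bullet> (V *v u))"
        using min[OF u(1)] t unfolding m_def by linarith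
      also have "\<dots> = u \<bullet> ((A + t *\<^sub>R V) *v u)"
        by (simp add: matrix_vector_mult_add_rdistrib inner_add_right scaleR_matrix_vector_assoc[symmetric])
      finally have "0 < (norm y)\<^sup>2 * (u \<bullet> ((A + t *\<^sub>R V) *v u))" using y by simp
      also have "\<dots> = (norm y *\<^sub>R u) \<bullet> ((A + t *\<^sub>R V) *v (norm y *\<^sub>R u))"
        by (simp add: power2_eq_square linear_scale[OF matrix_vector_mul_linear])
      finally show ?thesis using u(2) by simp
    qed
    moreover have "A + t *\<^sub>R V \<in> Sym"
      using A V subspace_Sym by (auto simp: SPD_def intro: subspace_add subspace_scale)
    ultimately show ?thesis by (simp add: SPD_def)
  qed
  have "((\<lambda>t::real. \<bar>t\<bar> * K) \<longlongrightarrow> \<bar>0\<bar> * K) (nhds 0)"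
    by (intro tendsto_intros) (simp add: filterlim_ident)
  then have "\<forall>\<^sub>F t in nhds 0. \<bar>t\<bar> * K < m"
    using m order_tendstoD(2) by fastforce
  then show ?thesis by (rule eventually_mono) (rule in_SPD)
qed

text \<open>\<open>vector_derivative\<close> is a choice, meaningful once the curve is known to be
  differentiable; the chain rule along the line shows that it is.\<close>

lemma has_dirderiv:
  assumes f: "smooth_map Sym SPD f" and A: "A \<in> SPD" and V: "V \<in> Sym"
  shows "((\<lambda>t. f (A + t *\<^sub>R V)) has_vector_derivative dirderiv f A V) (at 0)"
proof -
  have "Ck_on Sym SPD (Suc 0) f" using f unfolding smooth_map_def by blast
  then have "f differentiable (at A within SPD)" using A by simp
  then obtain f' where f': "(f has_derivative f') (at A within SPD)"
    unfolding differentiable_def by blast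
  define S where "S = {t::real. A + t *\<^sub>R V \<in> SPD}"
  have nhds: "\<forall>\<^sub>F t in nhds 0. t \<in> S" using SPD_eventually[OF A V] by (simp add: S_def)
  have line: "((\<lambda>t. A + t *\<^sub>R V) has_derivative (\<lambda>t. t *\<^sub>R V)) (at 0 within S)"
    by (auto intro!: derivative_eq_intros)
  have "(f has_derivative f') (at (A + 0 *\<^sub>R V) within (\<lambda>t. A + t *\<^sub>R V) ` S)"
    using f' by (auto simp: S_def intro: has_derivative_subset)
  from diff_chain_within[OF line this]
  have "((\<lambda>t. f (A + t *\<^sub>R V)) has_derivative (\<lambda>t. f' (t *\<^sub>R V))) (at 0 within S)"
    by (simp add: o_def)
  moreover have "at 0 within S = at 0"
    using nhds unfolding eventually_nhds
    by (metis (full_types) at_within_open_subset subsetI)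
  ultimately have "(\<lambda>t. f (A + t *\<^sub>R V)) differentiable (at 0)"
    unfolding differentiable_def by auto
  then show ?thesis unfolding dirderiv_def by (simp add: vector_derivative_works[symmetric])
qed

lemma has_vector_derivative_transform_eventually:
  assumes "(f has_vector_derivative f') (at x)" and "\<forall>\<^sub>F t in nhds x. f t = g t"
  shows "(g has_vector_derivative f') (at x)"
  using assms has_vector_derivative_cong_ev[where S = UNIV and x = x and f = f and g = g and f' = f']
    eventually_nhds_x_imp_x[OF assms(2)]
  by simp

text \<open>Transposition is linear and fixes the curve near 0, so it fixes the derivative
  too.\<close>

lemma dirderiv_Sym:
  assumes Y: "vector_field Sym SPD Y" and A: "A \<in> SPD" and V: "V \<in> Sym"
  shows "dirderiv Y A V \<in> Sym"
proof -
  have D: "((\<lambda>t. Y (A + t *\<^sub>R V)) has_vector_derivative dirderiv Y A V) (at 0)"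
    using Y by (intro has_dirderiv A V) (simp add: vector_field_def)
  have "\<forall>\<^sub>F t in nhds 0. transpose (Y (A + t *\<^sub>R V)) = Y (A + t *\<^sub>R V)"
    using SPD_eventually[OF A V] Y by (auto simp: vector_field_def Sym_def elim: eventually_mono)
  then have "((\<lambda>t. Y (A + t *\<^sub>R V)) has_vector_derivative transpose (dirderiv Y A V)) (at 0)"
    by (rule has_vector_derivative_transform_eventually[OF
          bounded_linear.has_vector_derivative[OF linear_linear[THEN iffD2, OF linear_transpose] D]])
  from vector_derivative_unique_at[OF this D] show ?thesis by (simp add: Sym_def)
qed

section \<open>Derivative of the Lyapunov solution along a line\<close>

text \<open>The difference quotient is \<open>u t\<close> itself, so continuity suffices. It serves
  for a \<open>u\<close> built from the solution \<open>G\<close>, at that stage known only to be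
  continuous.\<close>

lemma has_vector_derivative_scaleR_at_0:
  fixes u :: "real \<Rightarrow> 'a::real_normed_vector"
  assumes "isCont u 0"
  shows "((\<lambda>t. t *\<^sub>R u t) has_vector_derivative u 0) (at 0)"
proof -
  have "((\<lambda>t. norm (u t - u 0)) \<longlongrightarrow> 0) (at 0)"
    using assms by (simp add: isCont_def LIM_zero tendsto_norm_zero)
  then have "((\<lambda>t. norm (t *\<^sub>R u t - t *\<^sub>R u 0) / norm t) \<longlongrightarrow> 0) (at 0)"
    by (rule Lim_transform_eventually)
      (auto simp: eventually_at_filter scaleR_diff_right[symmetric])
  then show ?thesis
    unfolding has_vector_derivative_def has_derivative_iff_norm
    by (simp add: bounded_linear_scaleR_left)
qed

text \<open>Moving the terms in \<open>V\<close> to the right gives the fixed-point equation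
  \<open>G t = F t - t *\<^sub>R L (G t)\<close> with \<open>F\<close> differentiable. It yields
  first continuity of \<open>G\<close> at 0, then its derivative.\<close>

lemma Gam_has_vector_derivative:
  fixes y :: "real \<Rightarrow> real^'n^'n"
  assumes A: "A \<in> SPD" and V: "V \<in> Sym" and y: "(y has_vector_derivative y') (at 0)"
  defines "G \<equiv> \<lambda>t. Gam (A + t *\<^sub>R V) (y t)"
  shows "(G has_vector_derivative Gam A (y' - V ** G 0 - G 0 ** V)) (at 0)"
proof -
  have bl: "bounded_linear (Gam A)" using linear_Gam[OF A] by (simp add: linear_linear)
  define L where "L M = Gam A (V ** M + M ** V)" for M
  have L: "bounded_linear L"
    unfolding L_def using linear_compose[OF linear_lyapunov linear_Gam[OF A], of V]
    by (simp add: o_def linear_linear)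
  define F where "F t = Gam A (y t)" for t
  have F: "(F has_vector_derivative Gam A y') (at 0)"
    unfolding F_def by (rule bounded_linear.has_vector_derivative[OF bl y])
  have G_eq: "G t = F t - t *\<^sub>R L (G t)" if "A + t *\<^sub>R V \<in> SPD" for t
  proof -
    have "(A + t *\<^sub>R V) ** G t + G t ** (A + t *\<^sub>R V) = y t"
      unfolding G_def by (rule Gam_solves[OF that])
    then have "A ** G t + G t ** A = y t - t *\<^sub>R (V ** G t + G t ** V)"
      by (simp add: matrix_mult.add_left matrix_mult.add_right matrix_mult.scaleR_left
          matrix_mult.scaleR_right algebra_simps)
    then have "G t = Gam A (y t - t *\<^sub>R (V ** G t + G t ** V))"
      using Gam_eqI[OF A] by metis
    then show ?thesis
      by (simp only: F_def L_def linear_diff[OF linear_Gam[OF A]] linear_scale[OF linear_Gam[OF A]])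
  qed
  have G0: "G 0 = F 0" by (simp add: G_def F_def)
  define K where "K = onorm L"
  have K: "0 \<le> K" unfolding K_def by (rule onorm_pos_le[OF L])
  have F_cont: "(F \<longlongrightarrow> F 0) (at 0)"
    using has_vector_derivative_continuous[OF F] by (simp add: isCont_def)
  have "((\<lambda>t. \<bar>t\<bar> * K) \<longlongrightarrow> \<bar>0\<bar> * K) (at (0::real))" by (intro tendsto_intros)
  \<comment> \<open>Below 1/2 the error \<open>\<bar>t\<bar> * K * norm (G t)\<close> is at most
    half of \<open>norm (G t)\<close> and can be absorbed, so
    \<open>norm (G t) \<le> 2 * norm (F t)\<close>.\<close>
  then have "\<forall>\<^sub>F t::real in at 0. \<bar>t\<bar> * K < 1/2"
    using order_tendstoD(2)[of _ "\<bar>0\<bar> * K" _ "1/2"] by simp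
  moreover have "\<forall>\<^sub>F t in at 0. A + t *\<^sub>R V \<in> SPD"
    using SPD_eventually[OF A V] by (simp add: eventually_nhds_conv_at)
  ultimately have "\<forall>\<^sub>F t in at 0. norm (G t - F t) \<le> 2 * (\<bar>t\<bar> * K) * norm (F t)"
  proof eventually_elim
    case (elim t)
    have le: "norm (G t - F t) \<le> (\<bar>t\<bar> * K) * norm (G t)"
      using G_eq[OF elim(2)] onorm[OF L, of "G t"]
      by (metis (no_types, opaque_lifting) K_def add_diff_cancel_left' diff_add_cancel norm_minus_commute
          abs_ge_zero mult.assoc mult_left_mono norm_scaleR)
    also have "\<dots> \<le> (1/2) * norm (G t)" using elim(1) by (intro mult_right_mono) auto
    finally have "norm (G t) \<le> 2 * norm (F t)" using norm_triangle_sub[of "G t" "F t"] by simp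
    then have "(\<bar>t\<bar> * K) * norm (G t) \<le> (\<bar>t\<bar> * K) * (2 * norm (F t))"
      using K by (intro mult_left_mono) auto
    then show ?case using le by simp
  qed
  moreover have "((\<lambda>t. 2 * (\<bar>t\<bar> * K) * norm (F t)) \<longlongrightarrow> 2 * (\<bar>0\<bar> * K) * norm (F 0)) (at 0)"
    by (intro tendsto_intros F_cont)
  ultimately have "((\<lambda>t. G t - F t) \<longlongrightarrow> 0) (at 0)"
    using Lim_null_comparison by simp
  then have "(G \<longlongrightarrow> G 0) (at 0)"
    using tendsto_add[OF _ F_cont, of "\<lambda>t. G t - F t" 0] by (simp add: G0)
  then have "isCont (\<lambda>t. L (G t)) 0"
    using bounded_linear.tendsto[OF L] by (auto simp: isCont_def)
  \<comment> \<open>Differentiates the right side of the fixed-point equation, which equals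
    \<open>G\<close> near 0.\<close>
  note has_vector_derivative_diff[OF F has_vector_derivative_scaleR_at_0[OF this]]
  moreover have "\<forall>\<^sub>F t in nhds 0. F t - t *\<^sub>R L (G t) = G t"
    using SPD_eventually[OF A V] G_eq by (auto elim: eventually_mono)
  moreover have "Gam A y' - L (G 0) = Gam A (y' - V ** G 0 - G 0 ** V)"
    unfolding L_def by (simp add: linear_diff[OF linear_Gam[OF A], symmetric] algebra_simps)
  ultimately show ?thesis
    by (simp only: has_vector_derivative_transform_eventually)
qed

subsection \<open>The connection of the Wasserstein metric\<close>

text \<open>The asserted formula as an operator on fields, in the form that the uniqueness lemma
  compares with a given connection.\<close>

definition wasserstein_connection ::
    "(real^'n^'n \<Rightarrow> real^'n^'n) \<Rightarrow> (real^'n^'n \<Rightarrow> real^'n^'n) \<Rightarrow> real^'n^'n \<Rightarrow> real^'n^'n" where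
  "wasserstein_connection X Y A =
     dirderiv Y A (X A) - Gam A (X A) ** A ** Gam A (Y A) - Gam A (Y A) ** A ** Gam A (X A)"

text \<open>The two product terms trade places when \<open>X\<close> and \<open>Y\<close> do, so
  they cancel.\<close>

lemma torsion_free_wasserstein_connection: "torsion_free Sym SPD wasserstein_connection"
  by (simp add: torsion_free_def wasserstein_connection_def lie_bracket_def)

text \<open>Transposition exchanges the two summands; neither need be symmetric alone.\<close>

lemma christoffel_Sym:
  assumes A: "A \<in> SPD" and X: "X \<in> Sym" and Y: "Y \<in> Sym"
  shows "Gam A X ** A ** Gam A Y + Gam A Y ** A ** Gam A X \<in> Sym"
  using Gam_Sym[OF A X] Gam_Sym[OF A Y] A
  by (simp add: Sym_def SPD_def linear_add[OF linear_transpose] matrix_transpose_mul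
      matrix_mul_assoc add.commute)

lemma wasserstein_connection_Sym:
  assumes X: "vector_field Sym SPD X" and Y: "vector_field Sym SPD Y" and A: "A \<in> SPD"
  shows "wasserstein_connection X Y A \<in> Sym"
proof -
  have XY: "X A \<in> Sym" "Y A \<in> Sym" using X Y A by (auto simp: vector_field_def)
  then show ?thesis
    unfolding wasserstein_connection_def diff_diff_eq
    by (intro subspace_diff[OF subspace_Sym] dirderiv_Sym[OF Y A] christoffel_Sym[OF A])
qed

text \<open>Both sides are reduced to traces of words in \<open>A\<close>, \<open>a\<close>,
  \<open>b\<close>, \<open>c\<close> and of \<open>b ** Z'\<close> and \<open>c ** Y'\<close>, then
  matched by cyclicity.\<close>

lemma metric_compatible_wasserstein_connection:
  "metric_compatible Sym SPD gW wasserstein_connection"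
  unfolding metric_compatible_def
proof (intro allI impI ballI)
  fix X Y Z :: "real^'n^'n \<Rightarrow> real^'n^'n" and A :: "real^'n^'n"
  assume X: "vector_field Sym SPD X" and Y: "vector_field Sym SPD Y"
    and Z: "vector_field Sym SPD Z" and A: "A \<in> SPD"
  define V where "V = X A"
  have V: "V \<in> Sym" and YA: "Y A \<in> Sym" and ZA: "Z A \<in> Sym"
    using X Y Z A by (auto simp: vector_field_def V_def)
  define a b c where "a = Gam A V" and "b = Gam A (Y A)" and "c = Gam A (Z A)"
  define Y' Z' where "Y' = dirderiv Y A V" and "Z' = dirderiv Z A V"
  have DY: "((\<lambda>t. Y (A + t *\<^sub>R V)) has_vector_derivative Y') (at 0)"
    and DZ: "((\<lambda>t. Z (A + t *\<^sub>R V)) has_vector_derivative Z') (at 0)"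
    using Y Z by (auto simp: Y'_def Z'_def vector_field_def intro: has_dirderiv A V)
  define G where "G = (\<lambda>t. Gam (A + t *\<^sub>R V) (Y (A + t *\<^sub>R V)))"
  have DG: "(G has_vector_derivative Gam A (Y' - V ** b - b ** V)) (at 0)"
    using Gam_has_vector_derivative[OF A V DY] by (simp add: G_def b_def)
  have "((\<lambda>t. trace (G t ** Z (A + t *\<^sub>R V)) / 2) has_vector_derivative
      trace (b ** Z' + Gam A (Y' - V ** b - b ** V) ** Z A) / 2) (at 0)"
    using bounded_linear.has_vector_derivative[OF linear_linear[THEN iffD2, OF linear_trace]
        matrix_mult.has_vector_derivative[OF DG DZ], THEN has_vector_derivative_mult_left, of "1/2"]
    by (simp add: G_def b_def)
  \<comment> \<open>The trace formula for the metric holds only while the line stays in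
    \<open>SPD\<close>, hence for small \<open>t\<close>.\<close>
  moreover have "\<forall>\<^sub>F t in nhds 0. trace (G t ** Z (A + t *\<^sub>R V)) / 2
      = gW (A + t *\<^sub>R V) (Y (A + t *\<^sub>R V)) (Z (A + t *\<^sub>R V))"
    using SPD_eventually[OF A V]
  proof eventually_elim
    case (elim t)
    then show ?case using Y Z unfolding G_def vector_field_def by (intro gW_eq_trace[symmetric]) auto
  qed
  ultimately have "((\<lambda>t. gW (A + t *\<^sub>R V) (Y (A + t *\<^sub>R V)) (Z (A + t *\<^sub>R V))) has_vector_derivative
      trace (b ** Z' + Gam A (Y' - V ** b - b ** V) ** Z A) / 2) (at 0)"
    by (rule has_vector_derivative_transform_eventually)
  then have "dirderiv (\<lambda>q. gW q (Y q) (Z q)) A V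
      = trace (b ** Z' + Gam A (Y' - V ** b - b ** V) ** Z A) / 2"
    unfolding dirderiv_def by (rule vector_derivative_at)
  \<comment> \<open>Self-adjointness moves \<open>Gam A\<close> from the derivative term onto
    \<open>Z A\<close>, producing \<open>c\<close>.\<close>
  also have "\<dots> = (trace (b ** Z') + trace (c ** Y') - trace (c ** V ** b) - trace (c ** b ** V)) / 2"
    unfolding c_def by (simp add: trace_add trace_Gam_commute[OF A, of _ "Z A"] matrix_mult.diff_right
        trace_sub matrix_mul_assoc)
  finally have lhs: "dirderiv (\<lambda>q. gW q (Y q) (Z q)) A V
      = (trace (b ** Z') + trace (c ** Y') - trace (c ** V ** b) - trace (c ** b ** V)) / 2" .
  have "wasserstein_connection X Y A \<in> Sym" "wasserstein_connection X Z A \<in> Sym"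
    by (intro wasserstein_connection_Sym X Y Z A)+
  then have rhs: "gW A (wasserstein_connection X Y A) (Z A) + gW A (Y A) (wasserstein_connection X Z A)
      = (trace (c ** (Y' - a ** A ** b - b ** A ** a)) + trace (b ** (Z' - a ** A ** c - c ** A ** a))) / 2"
    using YA ZA
    by (simp add: gW_eq_trace[OF A] trace_Gam_commute[OF A, of _ "Z A"] wasserstein_connection_def
        a_def b_def c_def Y'_def Z'_def V_def add_divide_distrib)
  have V_eq: "V = A ** a + a ** A" unfolding a_def by (simp add: Gam_solves[OF A])
  \<comment> \<open>Replacing \<open>V\<close> by \<open>A ** a + a ** A\<close> gives four words.
    The middle two already occur in \<open>rhs\<close>; cyclic rotation brings the outer two into
    its form.\<close>
  have "trace (c ** V ** b) + trace (c ** b ** V)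
      = trace (c ** A ** a ** b) + trace (c ** a ** A ** b) + trace (c ** b ** A ** a) + trace (c ** b ** a ** A)"
    by (simp add: V_eq matrix_mult.add_left matrix_mult.add_right trace_add matrix_mul_assoc)
  moreover have "trace (c ** A ** a ** b) = trace (b ** c ** A ** a)"
    using trace_mul_sym[of "c ** A ** a" b] by (simp add: matrix_mul_assoc)
  moreover have "trace (c ** b ** a ** A) = trace (b ** a ** A ** c)"
    using trace_mul_sym[of c "b ** a ** A"] by (simp add: matrix_mul_assoc)
  ultimately have "dirderiv (\<lambda>q. gW q (Y q) (Z q)) A V
      = gW A (wasserstein_connection X Y A) (Z A) + gW A (Y A) (wasserstein_connection X Z A)"
    unfolding lhs rhs by (simp add: matrix_mult.diff_right trace_sub matrix_mul_assoc)
  then show "dirderiv (\<lambda>q. gW q (Y q) (Z q)) A (X A)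
      = gW A (wasserstein_connection X Y A) (Z A) + gW A (Y A) (wasserstein_connection X Z A)"
    by (simp add: V_def)
qed

section \<open>Identification of the Levi-Civita connection\<close>

theorem corollary4p3:
  fixes nabla :: "(real^'n^'n \<Rightarrow> real^'n^'n) \<Rightarrow> (real^'n^'n \<Rightarrow> real^'n^'n) \<Rightarrow> (real^'n^'n \<Rightarrow> real^'n^'n)"
    and X Y :: "real^'n^'n \<Rightarrow> real^'n^'n"
    and A :: "real^'n^'n"
  assumes "levi_civita Sym SPD gW nabla"
    and "vector_field Sym SPD X"
    and "vector_field Sym SPD Y"
    and "A \<in> SPD"
  shows "nabla X Y A =
           dirderiv Y A (X A) - Gam A (X A) ** A ** Gam A (Y A) - Gam A (Y A) ** A ** Gam A (X A)"
proof -
  have nabla: "affine_connection Sym SPD nabla" "torsion_free Sym SPD nabla"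
    "metric_compatible Sym SPD gW nabla"
    using assms(1) by (auto simp: levi_civita_def)
  \<comment> \<open>Places \<open>nabla X Y A\<close> in \<open>Sym\<close>, so its difference from
    the formula is a tangent vector to which definiteness applies.\<close>
  have "vector_field Sym SPD (nabla X Y)"
    if "vector_field Sym SPD X" "vector_field Sym SPD Y" for X Y
    using nabla(1)[unfolded affine_connection_def, THEN conjunct1] that by simp
  then have "nabla X Y A = wasserstein_connection X Y A"
    using assms(4)
    by (intro torsion_free_metric_compatible_unique[OF nabla(2) torsion_free_wasserstein_connection
          nabla(3) metric_compatible_wasserstein_connection assms(2-4) subspace_Sym]
        wasserstein_connection_Sym gW_diff_left gW_commute gW_definite)
      (auto simp: vector_field_def)
  then show ?thesis by (simp add: wasserstein_connection_def)
qed

end
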